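(* Let $\mathcal{A}$ be a unital C*-algebra and let $\tau$ be a faithful trace on $\mathcal{A}$. If $\mathcal{A}$ is finite dimensional, then the C*-norm metric $d_{\mathcal{A}}$ and the Bures metric $d_B^\tau$ on $D_\tau(\mathcal{A})$ are topologically equivalent.
   Context: A faithful trace $\tau$ is a positive linear functional with $\tau(ab)=\tau(ba)$ for all $a,b$, and $\tau(a^*a)=0$ only if $a=0$ (not necessarily of norm $1$). The density space is $D_\tau(\mathcal{A})=\{a\in\mathcal{A}_+:\tau(a)=1\}$, where $\mathcal{A}_+$ is the set of positive elements. The C*-norm metric is $d_{\mathcal{A}}(x,y)=\|x-y\|_{\mathcal{A}}$, restricted to $D_\tau(\mathcal{A})$. The Bures metric on $D_\tau(\mathcal{A})$ is $d_B^\tau(x,y)=\sqrt{1-\tau(|\sqrt{x}\sqrt{y}|)}$, where $\sqrt{\cdot}$ is the positive square root and $|a|=\sqrt{a^*a}$; it is known (Farenick–Rahaman) that $d_B^\tau$ is a metric. Two metrics on a set are topologically equivalent if they induce the same topology. *)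

theory Defs
  imports "HOL-Analysis.Analysis" "HOL-Library.Nonpos_Ints"
begin

class scaleC =
  fixes scaleC :: "complex \<Rightarrow> 'a \<Rightarrow> 'a" (infixr "*\<^sub>C" 75)

class star =
  fixes star :: "'a \<Rightarrow> 'a"

text \<open>
  Completeness, submultiplicativity of the norm and the unit come from \<^class>\<open>banach\<close>,
  \<^class>\<open>real_normed_algebra\<close> and \<^class>\<open>monoid_mult\<close>; the axiom \<open>scaleC_of_real\<close> makes the
  real structure of these classes the restriction of the complex one.  The class
  \<^class>\<open>real_normed_algebra_1\<close> is not used because it would exclude the zero algebra; in all
  other cases \<open>norm 1 = 1\<close> follows from the C*-identity.
\<close>

class unital_cstar_algebra = banach + real_normed_algebra + monoid_mult + scaleC + star +
  assumes scaleC_add_right: "c *\<^sub>C (x + y) = c *\<^sub>C x + c *\<^sub>C y"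
    and scaleC_add_left: "(c + d) *\<^sub>C x = c *\<^sub>C x + d *\<^sub>C x"
    and scaleC_scaleC: "c *\<^sub>C d *\<^sub>C x = (c * d) *\<^sub>C x"
    and scaleC_of_real: "complex_of_real r *\<^sub>C x = r *\<^sub>R x"
    and mult_scaleC_left: "(c *\<^sub>C x) * y = c *\<^sub>C (x * y)"
    and mult_scaleC_right: "x * (c *\<^sub>C y) = c *\<^sub>C (x * y)"
    and norm_scaleC: "norm (c *\<^sub>C x) = cmod c * norm x"
    and star_star: "star (star x) = x"
    and star_add: "star (x + y) = star x + star y"
    and star_scaleC: "star (c *\<^sub>C x) = cnj c *\<^sub>C star x"
    and star_mult: "star (x * y) = star y * star x"
    and cstar_identity: "norm (star x * x) = (norm x)\<^sup>2"

definition cstar_spectrum :: "'a::unital_cstar_algebra \<Rightarrow> complex set" where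
  "cstar_spectrum a = {z. \<not> (\<exists>b. (a - z *\<^sub>C 1) * b = 1 \<and> b * (a - z *\<^sub>C 1) = 1)}"

definition positive_elements :: "'a::unital_cstar_algebra set" where
  "positive_elements = {a. star a = a \<and> cstar_spectrum a \<subseteq> \<real>\<^sub>\<ge>\<^sub>0}"

definition pos_sqrt :: "'a::unital_cstar_algebra \<Rightarrow> 'a" where
  "pos_sqrt a = (THE b. b \<in> positive_elements \<and> b * b = a)"

definition cstar_abs :: "'a::unital_cstar_algebra \<Rightarrow> 'a" where
  "cstar_abs a = pos_sqrt (star a * a)"

definition finite_dim_algebra :: "'a::unital_cstar_algebra itself \<Rightarrow> bool" where
  "finite_dim_algebra _ \<longleftrightarrow>
     (\<exists>B. finite_dimensional_vector_space (scaleC :: complex \<Rightarrow> 'a \<Rightarrow> 'a) B)"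

definition faithful_trace :: "('a::unital_cstar_algebra \<Rightarrow> complex) \<Rightarrow> bool" where
  "faithful_trace \<tau> \<longleftrightarrow>
     Vector_Spaces.linear scaleC (*) \<tau> \<and>
     (\<forall>a\<in>positive_elements. \<tau> a \<in> \<real>\<^sub>\<ge>\<^sub>0) \<and>
     (\<forall>a b. \<tau> (a * b) = \<tau> (b * a)) \<and>
     (\<forall>a. \<tau> (star a * a) = 0 \<longrightarrow> a = 0)"

text \<open>
  The topology induced by a metric on the set \<open>M\<close>, given by the formula that defines
  \<^const>\<open>Metric_space.mtopology\<close>.  The latter is not used directly because the locale
  \<^locale>\<open>Metric_space\<close> requires nonnegativity and symmetry on the whole type, which
  \<open>bures_dist\<close> below satisfies only on the density space.
\<close>

definition induced_topology :: "'a set \<Rightarrow> ('a \<Rightarrow> 'a \<Rightarrow> real) \<Rightarrow> 'a topology" where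
  "induced_topology M d =
     topology (\<lambda>U. U \<subseteq> M \<and> (\<forall>x\<in>U. \<exists>r>0. {y \<in> M. d x y < r} \<subseteq> U))"

lemma openin_induced_topology:
  "openin (induced_topology M d) U \<longleftrightarrow>
     U \<subseteq> M \<and> (\<forall>x\<in>U. \<exists>r>0. {y \<in> M. d x y < r} \<subseteq> U)"
proof -
  let ?P = "\<lambda>U. U \<subseteq> M \<and> (\<forall>x\<in>U. \<exists>r>0. {y \<in> M. d x y < r} \<subseteq> U)"
  have "?P (S \<inter> T)" if S: "?P S" and T: "?P T" for S T
  proof (intro conjI ballI)
    show "S \<inter> T \<subseteq> M" using S by blast
    fix x assume "x \<in> S \<inter> T"
    then obtain r s where rs: "r > 0" "{y \<in> M. d x y < r} \<subseteq> S" "s > 0" "{y \<in> M. d x y < s} \<subseteq> T"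
      using S T by blast
    then have "min r s > 0 \<and> {y \<in> M. d x y < min r s} \<subseteq> S \<inter> T" by auto
    then show "\<exists>r>0. {y \<in> M. d x y < r} \<subseteq> S \<inter> T" by blast
  qed
  moreover have "?P (\<Union>K)" if K: "\<forall>S\<in>K. ?P S" for K
  proof (intro conjI ballI)
    show "\<Union>K \<subseteq> M" using K by blast
    fix x assume "x \<in> \<Union>K"
    then obtain S where S: "S \<in> K" "x \<in> S" by blast
    then obtain r where "r > 0" "{y \<in> M. d x y < r} \<subseteq> S" using K by blast
    then show "\<exists>r>0. {y \<in> M. d x y < r} \<subseteq> \<Union>K" using S by blast
  qed
  ultimately have "istopology ?P" unfolding istopology_def by blast
  then show ?thesis by (simp add: induced_topology_def topology_inverse')
qed

lemma (in Metric_space) induced_topology_eq_mtopology: "induced_topology M d = mtopology"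
proof -
  have "{y \<in> M. d x y < r} = mball x r" if "x \<in> M" for x r
    using that by auto
  then show ?thesis
    unfolding topology_eq openin_induced_topology openin_mtopology by (metis subsetD)
qed

definition density_space :: "('a::unital_cstar_algebra \<Rightarrow> complex) \<Rightarrow> 'a set" where
  "density_space \<tau> = {a \<in> positive_elements. \<tau> a = 1}"

definition cstar_dist :: "'a::unital_cstar_algebra \<Rightarrow> 'a \<Rightarrow> real" where
  "cstar_dist x y = norm (x - y)"

text \<open>The trace of the positive element \<^term>\<open>cstar_abs a\<close> is a nonnegative real, whence \<^term>\<open>Re\<close>.\<close>

definition bures_dist :: "('a::unital_cstar_algebra \<Rightarrow> complex) \<Rightarrow> 'a \<Rightarrow> 'a \<Rightarrow> real" where
  "bures_dist \<tau> x y = sqrt (1 - Re (\<tau> (cstar_abs (pos_sqrt x * pos_sqrt y))))"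

end

theory Submission
  imports Defs "HOL-Computational_Algebra.Fundamental_Theorem_Algebra"
begin

text \<open>
  Write \<open>tr a = Re (\<tau> a)\<close>, \<open>\<parallel>a\<parallel>\<^sub>2\<^sup>2 = tr (a\<^sup>* a)\<close>, and let \<open>r\<close>, \<open>s\<close> be the square roots of two density
  elements \<open>x\<close>, \<open>y\<close>, so that \<open>\<parallel>r\<parallel>\<^sub>2 = \<parallel>s\<parallel>\<^sub>2 = 1\<close> and the Bures distance \<open>b\<close> satisfies
  \<open>b\<^sup>2 = 1 - tr |rs|\<close>.  Each of the two metrics is bounded by a function of the other that tends to
  \<open>0\<close> at \<open>0\<close>.

  The Bures distance is small when the norm distance is small: since \<open>tr (rs) \<le> tr |rs|\<close>, one has
  \<open>2 b\<^sup>2 \<le> 2 - 2 tr (rs) = \<parallel>r - s\<parallel>\<^sub>2\<^sup>2\<close>, and \<open>\<parallel>r - s\<parallel>\<^sub>2\<^sup>2 \<le> \<parallel>r\<^sup>2 - s\<^sup>2\<parallel> tr 1 = \<parallel>x - y\<parallel> tr 1\<close>, which is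
  a form of the Powers--Stormer inequality (lemma \<open>sqrt_diff_trace_norm\<close>).

  For the converse (lemma \<open>norm_le_bures_dist\<close>), take a partial isometry \<open>u\<close> with
  \<open>u\<^sup>* (rs) = |rs|\<close> and put \<open>v = ru\<close>.  Then \<open>tr (v\<^sup>* s) = tr |rs|\<close> and \<open>\<parallel>v\<parallel>\<^sub>2 \<le> 1 = \<parallel>s\<parallel>\<^sub>2\<close>, so a small
  \<open>b\<close> means near-equality in the Cauchy--Schwarz inequality: \<open>v\<close> is close to \<open>s\<close>, and \<open>\<parallel>v\<parallel>\<^sub>2\<close> is
  close to \<open>1\<close>, so that little of \<open>r\<close> lies outside the range of the projection \<open>u u\<^sup>*\<close>.  Hence
  \<open>x = r\<^sup>2 \<approx> r u u\<^sup>* r = v v\<^sup>* \<approx> s s = y\<close>, all in \<open>\<parallel>\<cdot>\<parallel>\<^sub>2\<close>, which dominates the norm up to a constant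
  because the algebra has a finite orthonormal basis (lemma \<open>norm_le_trace_norm\<close>).  It is this last
  domination that fails in infinite dimension.

  The functional calculus behind these estimates is finite spectral theory: a self-adjoint element
  is annihilated by a polynomial, and since it has no nilpotent part, the unit is a sum of its
  eigenprojections (lemma \<open>spectral_resolution_exists\<close>).  Positivity of \<open>a\<^sup>* a\<close> comes from the trace:
  \<open>tr (a\<^sup>* b)\<close> is an inner product for which left multiplication by \<open>a\<^sup>* a\<close> is a positive operator.
\<close>

section \<open>Algebra in a unital C*-algebra\<close>

lemma scaleC_one: "1 *\<^sub>C x = (x::'a::unital_cstar_algebra)"
  using scaleC_of_real[of 1 x] by simp

interpretation cvec: vector_space "scaleC :: complex \<Rightarrow> 'a::unital_cstar_algebra \<Rightarrow> 'a"
  by unfold_locales (simp_all add: scaleC_add_right scaleC_add_left scaleC_scaleC scaleC_one)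

lemma scaleC_scaleR_commute: "c *\<^sub>C (r *\<^sub>R x) = r *\<^sub>R (c *\<^sub>C (x::'a::unital_cstar_algebra))"
  by (simp flip: scaleC_of_real add: scaleC_scaleC mult.commute)

lemma star_0 [simp]: "star (0::'a::unital_cstar_algebra) = 0"
  by (metis add_cancel_right_right star_add)

lemma star_1 [simp]: "star (1::'a::unital_cstar_algebra) = 1"
  by (metis mult.right_neutral star_mult star_star)

lemma star_minus: "star (- x) = - star (x::'a::unital_cstar_algebra)"
  by (metis add.right_inverse add_eq_0_iff star_0 star_add)

lemma star_diff: "star (x - y) = star x - star (y::'a::unital_cstar_algebra)"
  by (metis diff_conv_add_uminus star_add star_minus)

lemma star_scaleR: "star (r *\<^sub>R x) = r *\<^sub>R star (x::'a::unital_cstar_algebra)"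
  by (metis complex_cnj_complex_of_real scaleC_of_real star_scaleC)

lemma star_sum: "star (sum f A) = (\<Sum>i\<in>A. star (f i :: 'a::unital_cstar_algebra))"
  by (induction A rule: infinite_finite_induct) (simp_all add: star_add)

lemma star_mult_self_eq_0: "star x * x = 0 \<longleftrightarrow> x = (0::'a::unital_cstar_algebra)"
  using cstar_identity[of x] by auto

lemma norm_star: "norm (star x) = norm (x::'a::unital_cstar_algebra)"
proof -
  have le: "norm y \<le> norm (star y)" for y :: 'a
  proof (cases "y = 0")
    case False
    have "norm y * norm y \<le> norm (star y) * norm y"
      using norm_mult_ineq[of "star y" y] by (simp add: cstar_identity power2_eq_square)
    then show ?thesis using False by simp
  qed simp
  from le[of x] le[of "star x"] show ?thesis by (simp add: star_star)
qed

text \<open>A normal operator has no nilpotent part: both steps are instances of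
  \<open>x\<^sup>* x = 0 \<Longrightarrow> x = 0\<close>.  This is what makes normal elements diagonalisable.\<close>

lemma normal_square_annihilates:
  fixes x d :: "'a::unital_cstar_algebra"
  assumes normal: "star x * x = x * star x" and "x * (x * d) = 0"
  shows "x * d = 0"
proof -
  define e where "e = x * d"
  have xe: "x * e = 0" using assms(2) by (simp add: e_def)
  have "star (star x * e) * (star x * e) = star e * (x * star x) * e"
    by (simp add: star_mult star_star mult.assoc)
  also have "\<dots> = star e * star x * (x * e)"
    by (simp flip: normal add: mult.assoc)
  also have "\<dots> = 0" by (simp add: xe)
  finally have "star x * e = 0" by (simp add: star_mult_self_eq_0)
  then have "star e * e = 0"
    by (simp add: e_def star_mult mult.assoc)
  then show ?thesis by (simp add: star_mult_self_eq_0 e_def)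
qed

text \<open>An eigenvector \<open>c\<close> for \<open>z\<close> gives \<open>c\<^sup>* a c = z c\<^sup>* c\<close>, and the left-hand side is self-adjoint.\<close>

lemma selfadjoint_eigenvalue_real:
  fixes a c :: "'a::unital_cstar_algebra"
  assumes sa: "star a = a" and ac: "a * c = z *\<^sub>C c" and c: "c \<noteq> 0"
  shows "Im z = 0"
proof -
  have "star c * (a * c) = z *\<^sub>C (star c * c)"
    by (simp add: ac mult_scaleC_right)
  moreover have "star (a * c) * c = cnj z *\<^sub>C (star c * c)"
    by (simp add: ac star_scaleC mult_scaleC_left)
  ultimately have "z *\<^sub>C (star c * c) = cnj z *\<^sub>C (star c * c)"
    by (simp add: star_mult sa mult.assoc)
  then have "z = cnj z"
    using c by (simp add: star_mult_self_eq_0)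
  then show ?thesis by (simp add: complex_eq_iff)
qed

section \<open>Spectral resolution in finite dimension\<close>

text \<open>In finite dimension left multiplication by \<open>a - z\<close> is surjective as soon as it is injective.\<close>

lemma spectrum_iff_eigenvalue:
  fixes a :: "'a::unital_cstar_algebra"
  assumes fd: "finite_dim_algebra TYPE('a)"
  shows "z \<in> cstar_spectrum a \<longleftrightarrow> (\<exists>c. c \<noteq> 0 \<and> a * c = z *\<^sub>C c)"
proof -
  define x where "x = a - z *\<^sub>C 1"
  obtain B where "finite_dimensional_vector_space (scaleC :: complex \<Rightarrow> 'a \<Rightarrow> 'a) B"
    using fd by (auto simp: finite_dim_algebra_def)
  then interpret fd: finite_dimensional_vector_space "scaleC :: complex \<Rightarrow> 'a \<Rightarrow> 'a" B .
  have eig: "a * c = z *\<^sub>C c \<longleftrightarrow> x * c = 0" for c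
    by (simp add: x_def left_diff_distrib mult_scaleC_left)
  have lin: "Vector_Spaces.linear scaleC scaleC ((*) x)"
    by unfold_locales (simp_all add: scaleC_add_right scaleC_add_left scaleC_scaleC scaleC_one
        distrib_left mult_scaleC_right)
  show ?thesis
  proof
    assume z: "z \<in> cstar_spectrum a"
    show "\<exists>c. c \<noteq> 0 \<and> a * c = z *\<^sub>C c"
    proof (rule ccontr)
      assume "\<not> ?thesis"
      then have inj0: "x * c = 0 \<Longrightarrow> c = 0" for c using eig by blast
      then have "inj ((*) x)"
        by (intro injI) (metis eq_iff_diff_eq_0 right_diff_distrib)
      then have "surj ((*) x)" using fd.linear_inj_imp_surj[OF lin] by blast
      then obtain b where b: "x * b = 1" by (metis surjD)
      then have "x * (b * x - 1) = 0"
        by (simp add: right_diff_distrib flip: mult.assoc)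
      then have "b * x = 1" using inj0 by fastforce
      then show False using z b by (auto simp: cstar_spectrum_def x_def)
    qed
  next
    assume "\<exists>c. c \<noteq> 0 \<and> a * c = z *\<^sub>C c"
    then obtain c where c: "c \<noteq> 0" "x * c = 0" using eig by blast
    have "b * x \<noteq> 1" for b
    proof
      assume "b * x = 1"
      then have "c = b * (x * c)" by (simp flip: mult.assoc)
      then show False using c by simp
    qed
    then show "z \<in> cstar_spectrum a" by (auto simp: cstar_spectrum_def x_def)
  qed
qed

definition poly_eval :: "complex poly \<Rightarrow> 'a::unital_cstar_algebra \<Rightarrow> 'a" where
  "poly_eval q a = (\<Sum>i\<le>degree q. coeff q i *\<^sub>C a ^ i)"

lemma poly_eval_eq_sum:
  "degree q \<le> n \<Longrightarrow> poly_eval q a = (\<Sum>i\<le>n. coeff q i *\<^sub>C a ^ i)"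
  unfolding poly_eval_def by (rule sum.mono_neutral_left) (auto intro: coeff_eq_0)

lemma poly_eval_add: "poly_eval (p + q) a = poly_eval p a + poly_eval q a"
proof -
  define n where "n = max (degree p) (degree q)"
  have "degree (p + q) \<le> n" "degree p \<le> n" "degree q \<le> n"
    by (auto simp: n_def intro: degree_add_le_max)
  then show ?thesis
    by (simp add: poly_eval_eq_sum scaleC_add_left sum.distrib)
qed

lemma poly_eval_smult: "poly_eval (smult c q) a = c *\<^sub>C poly_eval q a"
proof -
  have "poly_eval (smult c q) a = (\<Sum>i\<le>degree q. coeff (smult c q) i *\<^sub>C a ^ i)"
    by (rule poly_eval_eq_sum) (rule degree_smult_le)
  then show ?thesis
    by (simp add: poly_eval_def cvec.scale_sum_right scaleC_scaleC)
qed

lemma poly_eval_pCons: "poly_eval (pCons c q) a = c *\<^sub>C 1 + a * poly_eval q a"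
proof -
  have "poly_eval (pCons c q) a = (\<Sum>i\<le>Suc (degree q). coeff (pCons c q) i *\<^sub>C a ^ i)"
    by (rule poly_eval_eq_sum) (rule degree_pCons_le)
  also have "\<dots> = c *\<^sub>C 1 + (\<Sum>i\<le>degree q. coeff q i *\<^sub>C (a * a ^ i))"
    by (subst sum.atMost_Suc_shift) simp
  finally show ?thesis
    by (simp add: poly_eval_def sum_distrib_left mult_scaleC_right)
qed

lemma poly_eval_monom: "poly_eval (monom 1 n) a = a ^ n"
  by (simp add: poly_eval_def degree_monom_eq coeff_monom if_distrib[of "\<lambda>c. c *\<^sub>C _"] cong: if_cong)

lemma poly_eval_linear_factor:
  "poly_eval ([:-w, 1:] * q) a = (a - w *\<^sub>C 1) * poly_eval q a"
proof -
  have "[:-w, 1:] * q = pCons 0 q + smult (- w) q" by simp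
  then have "poly_eval ([:-w, 1:] * q) a = a * poly_eval q a + (- w) *\<^sub>C poly_eval q a"
    by (simp only: poly_eval_add poly_eval_smult poly_eval_pCons) simp
  then show ?thesis by (simp add: left_diff_distrib mult_scaleC_left)
qed

text \<open>The powers of \<open>a\<close> span spaces of bounded dimension, so some power lies in the span of the
  smaller ones.\<close>

lemma annihilating_polynomial:
  fixes a :: "'a::unital_cstar_algebra"
  assumes fd: "finite_dim_algebra TYPE('a)"
  obtains q where "q \<noteq> 0" "poly_eval q a = 0"
proof -
  obtain B where "finite_dimensional_vector_space (scaleC :: complex \<Rightarrow> 'a \<Rightarrow> 'a) B"
    using fd by (auto simp: finite_dim_algebra_def)
  then interpret fd: finite_dimensional_vector_space "scaleC :: complex \<Rightarrow> 'a \<Rightarrow> 'a" B .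
  let ?V = "\<lambda>n. (\<lambda>i. a ^ i) ` {..<n}"
  have "\<exists>n. a ^ n \<in> cvec.span (?V n)"
  proof (rule ccontr)
    assume neg: "\<not> ?thesis"
    have "cvec.independent (?V n) \<and> card (?V n) = n" for n
    proof (induction n)
      case (Suc n)
      have V: "?V (Suc n) = insert (a ^ n) (?V n)" by (auto simp: lessThan_Suc)
      have "a ^ n \<notin> ?V n" using neg cvec.span_base by metis
      then have "card (insert (a ^ n) (?V n)) = Suc n"
        using Suc by (simp add: card_insert_disjoint)
      then show ?case
        unfolding V using Suc neg by (metis cvec.independent_insertI)
    qed (simp add: cvec.independent_empty)
    then have "Suc fd.dimension \<le> cvec.dim (?V (Suc fd.dimension))"
      using fd.independent_card_le_dim[of "?V (Suc fd.dimension)" "?V (Suc fd.dimension)"] by force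
    then show False using fd.dim_subset_UNIV[of "?V (Suc fd.dimension)"] by linarith
  qed
  then obtain n where n: "a ^ n \<in> cvec.span (?V n)" by blast
  have "x \<in> cvec.span (?V n) \<Longrightarrow> \<exists>q. (q = 0 \<or> degree q < n) \<and> x = poly_eval q a" for x
  proof (induction rule: cvec.span_induct_alt)
    case base
    show ?case by (rule exI[of _ 0]) (simp add: poly_eval_def)
  next
    case (step c x y)
    then obtain i q where *: "i < n" "x = a ^ i" "q = 0 \<or> degree q < n" "y = poly_eval q a" by auto
    have "degree (smult c (monom 1 i) + q) < n"
    proof (rule degree_add_less)
      show "degree (smult c (monom 1 i)) < n"
        using * degree_smult_le[of c "monom 1 i"] by (simp add: degree_monom_eq)
      show "degree q < n" using * by auto
    qed
    then show ?case
      using *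
      by (intro exI[of _ "smult c (monom 1 i) + q"]) (simp add: poly_eval_add poly_eval_smult poly_eval_monom)
  qed
  then obtain q where q: "q = 0 \<or> degree q < n" "a ^ n = poly_eval q a" using n by blast
  show thesis
  proof
    have "coeff q n = 0" using q(1) coeff_eq_0 by auto
    then have "coeff (monom 1 n + smult (-1) q) n = 1" by simp
    then show "monom 1 n + smult (-1) q \<noteq> 0" by force
    show "poly_eval (monom 1 n + smult (-1) q) a = 0"
      unfolding poly_eval_add poly_eval_smult poly_eval_monom q(2) by simp
  qed
qed

text \<open>The polynomial splits into linear factors, which are treated one at a time: if \<open>(a - w) c\<close>
  is a sum of eigenvectors, then subtracting from \<open>c\<close> suitable multiples of those for eigenvalues
  other than \<open>w\<close> leaves an element killed by \<open>(a - w)\<^sup>2\<close>, hence by \<open>a - w\<close>.\<close>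

lemma annihilated_imp_sum_eigenvectors:
  fixes a c :: "'a::unital_cstar_algebra"
  assumes sa: "star a = a" and "q \<noteq> 0" and "poly_eval q a * c = 0"
  shows "\<exists>S f. finite S \<and> (\<forall>z\<in>S. a * f z = z *\<^sub>C f z) \<and> c = (\<Sum>z\<in>S. f z)"
  using assms(2,3)
proof (induction "degree q" arbitrary: q c)
  case 0
  then obtain k where k: "q = [:k:]" "k \<noteq> 0"
    by (metis degree_eq_zeroE pCons_eq_0_iff)
  then have "k *\<^sub>C c = 0" using 0 by (simp add: poly_eval_def mult_scaleC_left)
  then show ?case using k by (intro exI[of _ "{}"]) simp
next
  case (Suc n)
  have "\<not> (\<exists>k l. k \<noteq> 0 \<and> l = 0 \<and> q = pCons k l)" using Suc.hyps(2) by auto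
  then obtain w where "poly q w = 0" using fundamental_theorem_of_algebra_alt by blast
  then obtain r where r: "q = [:-w, 1:] * r" by (metis poly_eq_0_iff_dvd dvdE)
  have r0: "r \<noteq> 0" using Suc.prems(1) r by auto
  have deg: "n = degree r" using Suc.hyps(2) r0 unfolding r by (simp add: degree_mult_eq del: mult_pCons_left)
  define x where "x = a - w *\<^sub>C 1"
  have comm: "poly_eval r a * a = a * poly_eval r a"
    by (simp add: poly_eval_def sum_distrib_left sum_distrib_right mult_scaleC_left
        mult_scaleC_right power_commutes)
  have "poly_eval r a * (x * c) = x * (poly_eval r a * c)"
    unfolding x_def left_diff_distrib right_diff_distrib mult_scaleC_left mult_scaleC_right
    by (simp add: comm flip: mult.assoc)
  also have "\<dots> = poly_eval q a * c"
    unfolding r poly_eval_linear_factor x_def by (simp add: mult.assoc)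
  finally have "poly_eval r a * (x * c) = 0" using Suc.prems(2) by simp
  from Suc.hyps(1)[OF deg r0 this] obtain S g where
    S: "finite S" and g: "\<And>z. z \<in> S \<Longrightarrow> a * g z = z *\<^sub>C g z" and xc: "x * c = (\<Sum>z\<in>S. g z)"
    by blast
  define f where "f z = (1 / (z - w)) *\<^sub>C g z" for z
  define d where "d = c - (\<Sum>z\<in>S - {w}. f z)"
  have xg: "x * g z = (z - w) *\<^sub>C g z" if "z \<in> S" for z
    using g[OF that] by (simp add: x_def left_diff_distrib mult_scaleC_left cvec.scale_left_diff_distrib)
  have xf: "x * f z = g z" if "z \<in> S - {w}" for z
    using that xg[of z] by (simp add: f_def mult_scaleC_right scaleC_scaleC scaleC_one)
  have "x * d = (\<Sum>z\<in>S. g z) - (\<Sum>z\<in>S - {w}. g z)"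
    by (simp add: d_def right_diff_distrib xc sum_distrib_left xf)
  also have "\<dots> = (if w \<in> S then g w else 0)"
    using S by (simp add: sum.remove)
  finally have "x * (x * d) = 0" using xg[of w] by simp
  moreover have "star x * x = x * star x"
    by (simp add: x_def star_diff star_scaleC sa algebra_simps mult_scaleC_left mult_scaleC_right
        scaleC_scaleC)
  ultimately have xd: "x * d = 0" by (rule normal_square_annihilates[rotated])
  show ?case
  proof (intro exI conjI ballI)
    let ?f = "f(w := d)"
    show "finite (insert w (S - {w}))" using S by simp
    show "a * ?f z = z *\<^sub>C ?f z" if "z \<in> insert w (S - {w})" for z
    proof (cases "z = w")
      case True
      then show ?thesis using xd by (simp add: x_def left_diff_distrib mult_scaleC_left)
    next
      case False
      then show ?thesis
        using g[of z] that by (simp add: f_def mult_scaleC_right scaleC_scaleC mult.commute)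
    qed
    have "(\<Sum>z\<in>insert w (S - {w}). ?f z) = ?f w + (\<Sum>z\<in>S - {w}. ?f z)"
      by (rule sum.insert) (use S in auto)
    also have "(\<Sum>z\<in>S - {w}. ?f z) = (\<Sum>z\<in>S - {w}. f z)"
      by (rule sum.cong) auto
    finally have "(\<Sum>z\<in>insert w (S - {w}). ?f z) = d + (\<Sum>z\<in>S - {w}. f z)"
      by simp
    then show "c = (\<Sum>z\<in>insert w (S - {w}). ?f z)" by (simp add: d_def)
  qed
qed

text \<open>Requiring \<open>p z \<noteq> 0\<close> makes every \<open>z \<in> S\<close> an eigenvalue, so that \<open>S\<close> consists of nonnegative numbers
  when \<open>a\<close> is positive.\<close>

definition spectral_resolution :: "'a::unital_cstar_algebra \<Rightarrow> real set \<Rightarrow> (real \<Rightarrow> 'a) \<Rightarrow> bool" where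
  "spectral_resolution a S p \<longleftrightarrow>
     finite S \<and>
     (\<forall>z\<in>S. star (p z) = p z \<and> p z \<noteq> 0 \<and> a * p z = z *\<^sub>R p z) \<and>
     (\<forall>z\<in>S. \<forall>w\<in>S. p z * p w = (if z = w then p z else 0)) \<and>
     (\<Sum>z\<in>S. p z) = 1"

text \<open>The functional calculus: \<open>spectral_sum S p f\<close> is \<open>f(a)\<close> for a spectral resolution of \<open>a\<close>.\<close>

definition spectral_sum :: "real set \<Rightarrow> (real \<Rightarrow> 'a) \<Rightarrow> (real \<Rightarrow> real) \<Rightarrow> 'a::unital_cstar_algebra" where
  "spectral_sum S p f = (\<Sum>z\<in>S. f z *\<^sub>R p z)"

text \<open>Eigenvectors \<open>f z\<close>, \<open>f w\<close> for different real eigenvalues satisfy \<open>(f z)\<^sup>* f w = 0\<close>.  Hence if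
  they sum to \<open>1\<close>, then \<open>f w = \<Sum>z. (f z)\<^sup>* f w = (f w)\<^sup>* f w\<close>, which makes each \<open>f w\<close> a projection.\<close>

lemma spectral_resolution_exists:
  fixes a :: "'a::unital_cstar_algebra"
  assumes fd: "finite_dim_algebra TYPE('a)" and sa: "star a = a"
  obtains S p where "spectral_resolution a S p"
proof -
  obtain q where q: "q \<noteq> 0" "poly_eval q a = 0" using annihilating_polynomial[OF fd] .
  obtain S f where S: "finite S" and f: "\<And>z. z \<in> S \<Longrightarrow> a * f z = z *\<^sub>C f z" and one: "1 = (\<Sum>z\<in>S. f z)"
    using annihilated_imp_sum_eigenvectors[OF sa q(1), of 1] q(2) by auto
  define R where "R = {x. complex_of_real x \<in> S \<and> f (complex_of_real x) \<noteq> 0}"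
  define p where "p x = f (complex_of_real x)" for x
  have im: "complex_of_real ` R = {z\<in>S. f z \<noteq> 0}"
  proof (intro set_eqI iffI)
    fix z assume z: "z \<in> {z\<in>S. f z \<noteq> 0}"
    then have "z = complex_of_real (Re z)"
      using selfadjoint_eigenvalue_real[OF sa f] by (auto simp: complex_eq_iff)
    then show "z \<in> complex_of_real ` R"
      using z by (auto simp: R_def intro!: image_eqI[of _ _ "Re z"])
  qed (auto simp: R_def)
  have R: "finite R"
    using S by (intro finite_imageD[of complex_of_real]) (auto simp: im inj_on_def)
  have ap: "a * p z = z *\<^sub>R p z" if "z \<in> R" for z
    using f that by (simp add: R_def p_def scaleC_of_real)
  have p1: "(\<Sum>z\<in>R. p z) = 1"
  proof -
    have "(\<Sum>z\<in>R. p z) = (\<Sum>z\<in>complex_of_real ` R. f z)"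
      by (simp add: sum.reindex inj_on_def p_def)
    also have "\<dots> = (\<Sum>z\<in>S. f z)"
      unfolding im using S by (intro sum.mono_neutral_left) auto
    finally show ?thesis using one by simp
  qed
  have orth: "star (p z) * p w = 0" if "z \<in> R" "w \<in> R" "z \<noteq> w" for z w
  proof -
    have "star (p z) * (a * p w) = w *\<^sub>R (star (p z) * p w)"
      using ap that by simp
    moreover have "star (a * p z) * p w = z *\<^sub>R (star (p z) * p w)"
      using ap that by (simp add: star_scaleR)
    ultimately have "(z - w) *\<^sub>R (star (p z) * p w) = 0"
      by (simp only: star_mult sa mult.assoc scaleR_left_diff_distrib) simp
    then show ?thesis using that(3) by (metis eq_iff_diff_eq_0 scaleR_eq_0_iff)
  qed
  have pp: "p w = star (p w) * p w" if w: "w \<in> R" for w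
  proof -
    have "p w = star (\<Sum>z\<in>R. p z) * p w" by (simp add: p1)
    also have "\<dots> = (\<Sum>z\<in>R. star (p z) * p w)" by (simp add: star_sum sum_distrib_right)
    also have "\<dots> = (\<Sum>z\<in>R. if z = w then star (p w) * p w else 0)"
      using orth w by (intro sum.cong) auto
    finally show ?thesis using w R by simp
  qed
  have sp: "star (p w) = p w" if w: "w \<in> R" for w
    by (subst (1 2) pp[OF w]) (simp add: star_mult star_star)
  have "spectral_resolution a R p"
    unfolding spectral_resolution_def
    using R ap p1 sp orth pp by (auto simp: R_def p_def)
  then show thesis ..
qed

lemma spectral_sum_mult:
  assumes "spectral_resolution a S p"
  shows "spectral_sum S p f * spectral_sum S p g = spectral_sum S p (\<lambda>z. f z * g z)"
proof -
  have "spectral_sum S p f * spectral_sum S p g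
      = (\<Sum>z\<in>S. \<Sum>w\<in>S. (f z * g w) *\<^sub>R (p z * p w))"
    by (simp add: spectral_sum_def sum_product mult.commute)
  also have "\<dots> = (\<Sum>z\<in>S. \<Sum>w\<in>S. if w = z then (f z * g z) *\<^sub>R p z else 0)"
    using assms by (intro sum.cong refl) (auto simp: spectral_resolution_def)
  finally show ?thesis
    using assms by (simp add: spectral_sum_def spectral_resolution_def)
qed

lemma spectral_sum_id:
  assumes "spectral_resolution a S p"
  shows "spectral_sum S p (\<lambda>z. z) = a"
proof -
  have "a = a * (\<Sum>z\<in>S. p z)" using assms by (simp add: spectral_resolution_def)
  also have "\<dots> = (\<Sum>z\<in>S. z *\<^sub>R p z)"
    unfolding sum_distrib_left using assms by (intro sum.cong) (auto simp: spectral_resolution_def)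
  finally show ?thesis by (simp add: spectral_sum_def)
qed

lemma star_spectral_sum:
  assumes "spectral_resolution a S p"
  shows "star (spectral_sum S p f) = spectral_sum S p f"
  unfolding spectral_sum_def star_sum star_scaleR
  using assms by (intro sum.cong) (auto simp: spectral_resolution_def)

lemma spectral_sum_cong: "(\<And>z. z \<in> S \<Longrightarrow> f z = g z) \<Longrightarrow> spectral_sum S p f = spectral_sum S p g"
  by (simp add: spectral_sum_def)

section \<open>Eigenvalues and squares\<close>

lemma positive_selfadjoint: "a \<in> positive_elements \<Longrightarrow> star a = a"
  by (simp add: positive_elements_def)

lemma positive_iff_eigenvalues_nonneg:
  fixes a :: "'a::unital_cstar_algebra"
  assumes fd: "finite_dim_algebra TYPE('a)"
  shows "a \<in> positive_elements \<longleftrightarrow>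
    star a = a \<and> (\<forall>x c. c \<noteq> 0 \<longrightarrow> a * c = x *\<^sub>R c \<longrightarrow> x \<ge> 0)"
    (is "?P \<longleftrightarrow> ?Q")
proof
  assume P: ?P
  show ?Q
  proof (intro conjI allI impI)
    show "star a = a" using P by (simp add: positive_elements_def)
    fix x c assume "c \<noteq> 0" "a * c = x *\<^sub>R c"
    then have "complex_of_real x \<in> cstar_spectrum a"
      unfolding spectrum_iff_eigenvalue[OF fd] by (metis scaleC_of_real)
    then show "x \<ge> 0" using P by (auto simp: positive_elements_def)
  qed
next
  assume Q: ?Q
  have "z \<in> \<real>\<^sub>\<ge>\<^sub>0" if z: "z \<in> cstar_spectrum a" for z
  proof -
    obtain c where c: "c \<noteq> 0" "a * c = z *\<^sub>C c"
      using z unfolding spectrum_iff_eigenvalue[OF fd] by blast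
    have im: "Im z = 0" using selfadjoint_eigenvalue_real[OF _ c(2,1)] Q by blast
    then have "z = complex_of_real (Re z)" by (simp add: complex_eq_iff)
    then have "a * c = Re z *\<^sub>R c"
      using c(2) scaleC_of_real[of "Re z" c] by simp
    then have "Re z \<ge> 0" using Q c(1) by blast
    then show ?thesis using im by (simp add: complex_nonneg_Reals_iff)
  qed
  then have "cstar_spectrum a \<subseteq> \<real>\<^sub>\<ge>\<^sub>0" by (rule subsetI)
  then show ?P using Q by (simp add: positive_elements_def)
qed

lemma square_selfadjoint_positive:
  fixes s :: "'a::unital_cstar_algebra"
  assumes fd: "finite_dim_algebra TYPE('a)" and sa: "star s = s"
  shows "s * s \<in> positive_elements"
  unfolding positive_iff_eigenvalues_nonneg[OF fd]
proof (intro conjI allI impI)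
  show "star (s * s) = s * s" by (simp add: star_mult sa)
  fix x c assume c: "c \<noteq> 0" "s * s * c = x *\<^sub>R c"
  show "x \<ge> 0"
  proof (rule ccontr)
    assume "\<not> ?thesis"
    define m where "m = sqrt (- x)"
    have m: "m > 0" "m * m = - x" using \<open>\<not> x \<ge> 0\<close> by (auto simp: m_def)
    \<comment> \<open>\<open>s\<^sup>2 + m\<^sup>2 = (s + im)(s - im)\<close>, and neither factor kills a nonzero element.\<close>
    define e where "e = s * c - (\<i> * m) *\<^sub>C c"
    have "s * e = s * s * c - (\<i> * m) *\<^sub>C (s * c)"
      by (simp add: e_def right_diff_distrib mult_scaleC_right mult.assoc)
    also have "s * s * c = (\<i> * m * (\<i> * m)) *\<^sub>C c"
    proof -
      have "\<i> * complex_of_real m * (\<i> * complex_of_real m) = - complex_of_real (m * m)"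
        by (simp add: algebra_simps)
      then have "\<i> * complex_of_real m * (\<i> * complex_of_real m) = complex_of_real x"
        unfolding m by simp
      then show ?thesis using c by (simp only: scaleC_of_real)
    qed
    finally have se: "s * e = (- (\<i> * m)) *\<^sub>C e"
      by (simp add: e_def cvec.scale_right_diff_distrib scaleC_scaleC algebra_simps)
    have "e = 0"
      using selfadjoint_eigenvalue_real[OF sa se] m by auto
    then have "s * c = (\<i> * m) *\<^sub>C c" by (simp add: e_def)
    from selfadjoint_eigenvalue_real[OF sa this c(1)] show False using m by simp
  qed
qed

lemma selfadjoint_decomposition:
  fixes a :: "'a::unital_cstar_algebra"
  obtains s t where "star s = s" "star t = t" "a = s + \<i> *\<^sub>C t"
proof
  let ?s = "(1/2::complex) *\<^sub>C (a + star a)" and ?t = "(- \<i> / 2) *\<^sub>C (a - star a)"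
  show "star ?s = ?s" by (simp add: star_scaleC star_add star_star add.commute)
  show "star ?t = ?t"
    by (simp add: star_scaleC star_diff star_star cvec.scale_right_diff_distrib cvec.scale_minus_left)
  have "\<i> *\<^sub>C ?t = (1/2::complex) *\<^sub>C (a - star a)" by (simp add: scaleC_scaleC)
  moreover have "?s + (1/2::complex) *\<^sub>C (a - star a) = (1/2::complex) *\<^sub>C (a + a)"
    by (simp flip: scaleC_add_right)
  moreover have "a + a = (2::complex) *\<^sub>C a"
    using scaleC_add_left[of 1 1 a] by (simp add: scaleC_one)
  ultimately show "a = ?s + \<i> *\<^sub>C ?t" by (simp add: scaleC_scaleC scaleC_one)
qed

section \<open>The trace inner product\<close>

locale finite_dim_tracial =
  fixes \<tau> :: "'a::unital_cstar_algebra \<Rightarrow> complex"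
  assumes faithful: "faithful_trace \<tau>"
    and fd: "finite_dim_algebra TYPE('a)"
begin

definition tr :: "'a \<Rightarrow> real" where "tr a = Re (\<tau> a)"

lemma tau_add: "\<tau> (a + b) = \<tau> a + \<tau> b" and tau_scaleC: "\<tau> (c *\<^sub>C a) = c * \<tau> a"
proof -
  have "Vector_Spaces.linear scaleC (*) \<tau>" using faithful by (simp add: faithful_trace_def)
  then interpret l: Vector_Spaces.linear scaleC "(*)" \<tau> .
  show "\<tau> (a + b) = \<tau> a + \<tau> b" by (rule l.add)
  show "\<tau> (c *\<^sub>C a) = c * \<tau> a" by (rule l.scale)
qed

lemma tau_diff: "\<tau> (a - b) = \<tau> a - \<tau> b"
  using tau_add[of "a - b" b] by simp
lemma tr_add: "tr (a + b) = tr a + tr b" by (simp add: tr_def tau_add)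
lemma tr_scaleR: "tr (r *\<^sub>R a) = r * tr a" by (simp add: tr_def tau_scaleC flip: scaleC_of_real)
lemma tr_0 [simp]: "tr 0 = 0" using tr_scaleR[of 0 0] by simp
lemma tr_minus: "tr (- a) = - tr a" using tr_scaleR[of "-1" a] by simp
lemma tr_diff: "tr (a - b) = tr a - tr b" using tr_add[of a "- b"] by (simp add: tr_minus)
lemma tr_sum: "tr (sum f A) = (\<Sum>i\<in>A. tr (f i))"
  by (induction A rule: infinite_finite_induct) (simp_all add: tr_add)
lemma tau_commute: "\<tau> (a * b) = \<tau> (b * a)" using faithful by (simp add: faithful_trace_def)
lemma tr_commute: "tr (a * b) = tr (b * a)" by (simp add: tr_def tau_commute)
lemma tau_positive: "a \<in> positive_elements \<Longrightarrow> \<tau> a \<in> \<real>\<^sub>\<ge>\<^sub>0"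
  using faithful by (simp add: faithful_trace_def)
lemma tr_positive: "a \<in> positive_elements \<Longrightarrow> tr a \<ge> 0"
  using tau_positive by (auto simp: tr_def complex_nonneg_Reals_iff)

text \<open>\<open>2 s = (1 + s)\<^sup>2 - 1 - s\<^sup>2\<close> reduces this to squares, where the trace is known to be real.\<close>

lemma tau_selfadjoint_real:
  assumes "star s = s"
  shows "Im (\<tau> s) = 0"
proof -
  have sq: "Im (\<tau> (x * x)) = 0" if "star x = x" for x
    using tau_positive[OF square_selfadjoint_positive[OF fd that]] by (simp add: complex_nonneg_Reals_iff)
  have "(1 + s) * (1 + s) = 1 * 1 + (s + s) + s * s" by (simp add: algebra_simps)
  then have "Im (\<tau> ((1 + s) * (1 + s))) = Im (\<tau> (1 * 1)) + 2 * Im (\<tau> s) + Im (\<tau> (s * s))"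
    by (simp only: tau_add) simp
  moreover have "Im (\<tau> ((1 + s) * (1 + s))) = 0" by (rule sq) (simp add: star_add assms)
  moreover have "Im (\<tau> (1 * 1)) = 0" by (rule sq) simp
  ultimately show ?thesis using sq[OF assms] by linarith
qed

lemma tr_star: "tr (star a) = tr a"
proof -
  obtain s t where st: "star s = s" "star t = t" "a = s + \<i> *\<^sub>C t" by (rule selfadjoint_decomposition)
  then show ?thesis
    using tau_selfadjoint_real[of t]
    by (simp add: tr_def star_add star_scaleC tau_add tau_diff tau_scaleC)
qed

text \<open>With \<open>a = s + it\<close> one has \<open>a\<^sup>* a = s\<^sup>2 + t\<^sup>2 + i(st - ts)\<close>, and the trace kills the commutator.
  So \<open>tr (a\<^sup>* b)\<close> is a real inner product on the algebra, and the algebra acts on itself by left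
  multiplication as a *-algebra of operators.  Positivity of \<open>a\<^sup>* a\<close> is deduced from this.\<close>

lemma tr_star_mult_nonneg: "tr (star a * a) \<ge> 0"
  and tau_star_mult_real: "Im (\<tau> (star a * a)) = 0"
proof -
  obtain s t where st: "star s = s" "star t = t" "a = s + \<i> *\<^sub>C t" by (rule selfadjoint_decomposition)
  have "star a * a = s * s + t * t + (\<i> *\<^sub>C (s * t) + (- \<i>) *\<^sub>C (t * s))"
    by (simp add: st star_add star_scaleC algebra_simps mult_scaleC_left mult_scaleC_right scaleC_scaleC scaleC_one)
  then have *: "\<tau> (star a * a) = \<tau> (s * s) + \<tau> (t * t)"
    by (simp add: tau_add tau_diff tau_scaleC tau_commute[of s t])
  have "\<tau> (s * s) \<in> \<real>\<^sub>\<ge>\<^sub>0" "\<tau> (t * t) \<in> \<real>\<^sub>\<ge>\<^sub>0"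
    using st by (auto intro!: tau_positive square_selfadjoint_positive[OF fd])
  then show "tr (star a * a) \<ge> 0" "Im (\<tau> (star a * a)) = 0"
    by (auto simp: tr_def * complex_nonneg_Reals_iff)
qed

lemma tr_star_mult_eq_0: "tr (star a * a) = 0 \<longleftrightarrow> a = 0"
proof
  assume "tr (star a * a) = 0"
  then have "\<tau> (star a * a) = 0" using tau_star_mult_real[of a] by (simp add: tr_def complex_eq_iff)
  then show "a = 0" using faithful by (simp add: faithful_trace_def)
qed simp

lemma tr_star_mult_pos: "a \<noteq> 0 \<Longrightarrow> tr (star a * a) > 0"
  using tr_star_mult_nonneg[of a] tr_star_mult_eq_0[of a] by linarith

section \<open>Positive elements and their square roots\<close>

text \<open>Testing the form \<open>c \<mapsto> tr (c\<^sup>* a c)\<close> on an eigenvector shows that its eigenvalue is nonnegative.\<close>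

lemma positiveI:
  assumes sa: "star a = a" and nonneg: "\<And>c. tr (star c * a * c) \<ge> 0"
  shows "a \<in> positive_elements"
  unfolding positive_iff_eigenvalues_nonneg[OF fd]
proof (intro conjI allI impI)
  fix x c assume c: "c \<noteq> 0" "a * c = x *\<^sub>R c"
  have "x * tr (star c * c) \<ge> 0"
    using nonneg[of c] c by (simp add: mult.assoc tr_scaleR)
  then show "x \<ge> 0" using tr_star_mult_pos[OF c(1)] by (simp add: zero_le_mult_iff)
qed (fact sa)

lemma star_mult_positive: "star a * (a::'a) \<in> positive_elements"
proof (rule positiveI)
  show "tr (star c * (star a * a) * c) \<ge> 0" for c
    using tr_star_mult_nonneg[of "a * c"] by (simp add: star_mult mult.assoc)
qed (simp add: star_mult star_star)

lemma positive_has_sqrt: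
  fixes a :: 'a
  assumes "a \<in> positive_elements"
  shows "\<exists>r. r \<in> positive_elements \<and> r * r = a"
proof -
  have sa: "star a = a" using assms by (rule positive_selfadjoint)
  obtain S p where S: "spectral_resolution a S p" by (rule spectral_resolution_exists[OF fd sa])
  have pos: "z \<ge> 0" if "z \<in> S" for z
    using assms S that unfolding positive_iff_eigenvalues_nonneg[OF fd] by (auto simp: spectral_resolution_def)
  \<comment> \<open>The fourth root shows that the square root is itself a square, hence positive.\<close>
  define q where "q = spectral_sum S p (\<lambda>z. sqrt (sqrt z))"
  have q: "star q = q" unfolding q_def by (rule star_spectral_sum[OF S])
  have qq: "q * q = spectral_sum S p sqrt"
    unfolding q_def spectral_sum_mult[OF S] using pos by (intro spectral_sum_cong) simp
  have "q * q * (q * q) = spectral_sum S p (\<lambda>z. z)"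
    unfolding qq spectral_sum_mult[OF S] using pos by (intro spectral_sum_cong) simp
  then have "q * q * (q * q) = a" by (simp add: spectral_sum_id[OF S])
  then show ?thesis
    using square_selfadjoint_positive[OF fd q] by blast
qed

lemma tr_mult_nonneg:
  assumes "a \<in> positive_elements" "b \<in> positive_elements"
  shows "tr (a * b) \<ge> 0"
proof -
  obtain r where r: "r \<in> positive_elements" "r * r = a" using positive_has_sqrt[OF assms(1)] by blast
  obtain s where s: "s \<in> positive_elements" "s * s = b" using positive_has_sqrt[OF assms(2)] by blast
  note sa = positive_selfadjoint[OF r(1)] positive_selfadjoint[OF s(1)]
  have "tr (a * b) = tr ((r * r * s) * s)" by (simp flip: r(2) s(2) add: mult.assoc)
  also have "\<dots> = tr (star (r * s) * (r * s))" by (subst tr_commute) (simp add: star_mult sa mult.assoc)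
  finally show ?thesis using tr_star_mult_nonneg by simp
qed

text \<open>For \<open>d = b - b'\<close> the hypothesis says \<open>b d + d b' = 0\<close>, so \<open>tr (d b d) + tr (d b' d) = 0\<close> with
  both terms nonnegative; hence \<open>b d = 0\<close>, \<open>b' d = 0\<close> and \<open>d\<^sup>2 = 0\<close>.\<close>

lemma positive_sqrt_unique:
  fixes b b' :: 'a
  assumes b: "b \<in> positive_elements" and b': "b' \<in> positive_elements" and eq: "b * b = b' * b'"
  shows "b = b'"
proof -
  define d where "d = b - b'"
  have d: "star d = d" using positive_selfadjoint[OF b] positive_selfadjoint[OF b'] by (simp add: d_def star_diff)
  have "d * d \<in> positive_elements" by (rule square_selfadjoint_positive[OF fd d])
  then have n: "tr (b * (d * d)) \<ge> 0" "tr (b' * (d * d)) \<ge> 0" using tr_mult_nonneg b b' by auto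
  have "(b * d + d * b') * d = 0" by (simp add: d_def eq algebra_simps flip: mult.assoc)
  then have "tr (b * d * d) + tr (d * b' * d) = 0" by (simp add: distrib_right flip: tr_add)
  moreover have "tr (d * b' * d) = tr (b' * (d * d))" by (subst mult.assoc, subst tr_commute) (simp add: mult.assoc)
  ultimately have z: "tr (b * (d * d)) = 0" "tr (b' * (d * d)) = 0" using n by (auto simp: mult.assoc)
  have kill: "x * d = 0" if x: "x \<in> positive_elements" and xz: "tr (x * (d * d)) = 0" for x
  proof -
    obtain r where r: "r \<in> positive_elements" "r * r = x" using positive_has_sqrt[OF x] by blast
    have "tr (star (r * d) * (r * d)) = tr (d * (x * d))"
      by (simp add: star_mult d positive_selfadjoint[OF r(1)] mult.assoc flip: r(2))
    also have "\<dots> = 0" using xz by (subst tr_commute) (simp add: mult.assoc)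
    finally have "r * d = 0" using tr_star_mult_eq_0 by blast
    then show ?thesis by (simp flip: r(2) add: mult.assoc)
  qed
  have "star d * d = b * d - b' * d" unfolding d by (simp add: d_def left_diff_distrib)
  also have "\<dots> = 0" using kill b b' z by simp
  finally show ?thesis by (simp add: star_mult_self_eq_0 d_def)
qed

lemma pos_sqrt_mult_self: "(b::'a) \<in> positive_elements \<Longrightarrow> pos_sqrt (b * b) = b"
  unfolding pos_sqrt_def by (rule the_equality) (use positive_sqrt_unique in auto)

lemma pos_sqrt_works:
  fixes a :: 'a
  assumes "a \<in> positive_elements"
  shows "pos_sqrt a \<in> positive_elements" "pos_sqrt a * pos_sqrt a = a" "star (pos_sqrt a) = pos_sqrt a"
proof -
  obtain r where r: "r \<in> positive_elements" "r * r = a" using positive_has_sqrt[OF assms] by blast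
  then have "pos_sqrt a = r" using pos_sqrt_mult_self by blast
  then show "pos_sqrt a \<in> positive_elements" "pos_sqrt a * pos_sqrt a = a" "star (pos_sqrt a) = pos_sqrt a"
    using r positive_selfadjoint by auto
qed

lemma tr_star_mult_commute: "tr (star a * b) = tr (star b * a)"
  using tr_star[of "star a * b"] by (simp add: star_mult star_star)

lemma tr_star_mult_diff:
  "tr (star (a - b) * (a - b)) = tr (star a * a) + tr (star b * b) - 2 * tr (star a * b)"
  using tr_star_mult_commute[of a b] by (simp add: star_diff left_diff_distrib right_diff_distrib tr_diff)

section \<open>Comparison of the norms\<close>

text \<open>Since \<open>tr (a\<^sup>* b)\<close> is a real inner product, orthonormality is used over the reals; here \<open>span\<close>
  is the real span.  A complex basis \<open>B\<close> yields the real spanning set \<open>B \<union> \<i> B\<close>.\<close>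

lemma real_finite_span:
  obtains B :: "'a set" where "finite B" "span B = UNIV"
proof -
  obtain B where "finite_dimensional_vector_space (scaleC :: complex \<Rightarrow> 'a \<Rightarrow> 'a) B"
    using fd by (auto simp: finite_dim_algebra_def)
  then interpret fd: finite_dimensional_vector_space "scaleC :: complex \<Rightarrow> 'a \<Rightarrow> 'a" B .
  let ?B = "B \<union> scaleC \<i> ` B"
  have i: "\<i> *\<^sub>C x \<in> span ?B" if x: "x \<in> span ?B" for x
    using x
  proof (induction rule: span_induct_alt)
    case base
    show ?case by (simp add: span_zero)
  next
    case (step r b y)
    have "\<i> *\<^sub>C b \<in> span ?B"
    proof (cases "b \<in> B")
      case True
      then show ?thesis by (intro span_base) auto
    next
      case False
      then obtain b' where "b' \<in> B" "b = \<i> *\<^sub>C b'" using step by auto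
      then have "\<i> *\<^sub>C b = (-1) *\<^sub>R b'" using scaleC_of_real[of "-1" b'] by (simp add: scaleC_scaleC)
      then show ?thesis using \<open>b' \<in> B\<close> by (metis UnI1 span_base span_scale)
    qed
    then show ?case
      using step by (simp add: scaleC_add_right scaleC_scaleR_commute span_add span_scale)
  qed
  have sub: "cvec.subspace (span ?B)"
  proof (rule cvec.subspaceI)
    fix c x assume x: "x \<in> span ?B"
    have "c *\<^sub>C x = Re c *\<^sub>R x + Im c *\<^sub>R (\<i> *\<^sub>C x)"
      by (subst complex_eq[of c]) (simp add: scaleC_add_left scaleC_of_real mult.commute scaleC_scaleR_commute flip: scaleC_scaleC)
    then show "c *\<^sub>C x \<in> span ?B" using x i by (simp add: span_add span_scale)
  qed (auto simp: span_zero span_add)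
  have "B \<subseteq> span ?B" using span_superset[of ?B] by auto
  then have "cvec.span B \<subseteq> span ?B" using sub by (rule cvec.span_minimal)
  then have "span ?B = UNIV" using fd.span_Basis by auto
  then show thesis using that[of ?B] fd.finite_Basis by simp
qed

definition orthonormal :: "'a set \<Rightarrow> bool" where
  "orthonormal E \<longleftrightarrow> (\<forall>e\<in>E. \<forall>f\<in>E. tr (star e * f) = (if e = f then 1 else 0))"

text \<open>Gram--Schmidt orthogonalisation.\<close>

lemma orthonormal_span_exists:
  assumes "finite B"
  shows "\<exists>E. finite E \<and> orthonormal E \<and> B \<subseteq> span E"
  using assms
proof induction
  case empty
  show ?case by (intro exI[of _ "{}"]) (simp add: orthonormal_def)
next
  case (insert b B)
  then obtain E where E: "finite E" "orthonormal E" "B \<subseteq> span E" by blast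
  define w where "w = (\<Sum>e\<in>E. tr (star e * b) *\<^sub>R e)"
  have w: "w \<in> span E" unfolding w_def by (intro span_sum span_scale span_base)
  define v where "v = b - w"
  show ?case
  proof (cases "v = 0")
    case True
    then have "b \<in> span E" using w by (simp add: v_def)
    then show ?thesis using E by blast
  next
    case False
    define f where "f = (1 / sqrt (tr (star v * v))) *\<^sub>R v"
    have pos: "tr (star v * v) > 0" using tr_star_mult_pos[OF False] .
    have ff: "tr (star f * f) = 1" using pos by (simp add: f_def star_scaleR tr_scaleR)
    have ef: "tr (star e * f) = 0" if e: "e \<in> E" for e
    proof -
      have "tr (star e * w) = (\<Sum>g\<in>E. tr (star g * b) * tr (star e * g))"
        by (simp add: w_def sum_distrib_left tr_sum tr_scaleR)
      also have "\<dots> = (\<Sum>g\<in>E. if g = e then tr (star e * b) else 0)"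
        using E e by (intro sum.cong) (auto simp: orthonormal_def)
      also have "\<dots> = tr (star e * b)" using E e by simp
      finally show ?thesis by (simp add: f_def v_def tr_scaleR right_diff_distrib tr_diff)
    qed
    have "f \<notin> E" using ff ef by force
    moreover have "tr (star f * e) = 0" if "e \<in> E" for e
      using ef[OF that] by (simp add: tr_star_mult_commute[of f e])
    ultimately have "orthonormal (insert f E)"
      using E(2) ff ef by (simp add: orthonormal_def) metis
    moreover have "insert b B \<subseteq> span (insert f E)"
    proof -
      have sub: "span E \<subseteq> span (insert f E)" by (intro span_mono) auto
      have "v = sqrt (tr (star v * v)) *\<^sub>R f" using pos by (simp add: f_def)
      then have "v \<in> span (insert f E)" by (metis insertI1 span_base span_scale)
      then have "w + v \<in> span (insert f E)" using w sub by (intro span_add) auto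
      then show ?thesis using E sub by (auto simp: v_def)
    qed
    ultimately show ?thesis using E(1) by blast
  qed
qed

text \<open>Each coordinate of \<open>a\<close> in an orthonormal basis \<open>E\<close> is at most \<open>sqrt (tr (a\<^sup>* a))\<close>, so the sum of the
  norms of the basis elements serves as a constant; adding \<open>1\<close> keeps it positive in the zero
  algebra.\<close>

lemma norm_le_trace_norm:
  obtains C where "C > 0" "\<And>a. norm a \<le> C * sqrt (tr (star a * a))"
proof -
  obtain B :: "'a set" where B: "finite B" "span B = UNIV" by (rule real_finite_span)
  obtain E where E: "finite E" "orthonormal E" "B \<subseteq> span E"
    using orthonormal_span_exists[OF B(1)] by blast
  have UNIV: "span E = UNIV"
    using span_minimal[OF E(3) subspace_span] B by auto
  define C where "C = 1 + (\<Sum>e\<in>E. norm e)"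
  have "norm a \<le> C * sqrt (tr (star a * a))" for a :: 'a
  proof -
    have "a \<in> range (\<lambda>u. \<Sum>e\<in>E. u e *\<^sub>R e)"
      using UNIV unfolding span_finite[OF E(1)] by blast
    then obtain u where a: "a = (\<Sum>e\<in>E. u e *\<^sub>R e)" by blast
    have "tr (star a * a) = (\<Sum>e\<in>E. \<Sum>f\<in>E. (u e * u f) * tr (star e * f))"
      by (simp add: a star_sum star_scaleR sum_product tr_sum tr_scaleR ac_simps)
    also have "\<dots> = (\<Sum>e\<in>E. \<Sum>f\<in>E. if f = e then u e * u e else 0)"
      using E by (intro sum.cong refl) (auto simp: orthonormal_def)
    also have "\<dots> = (\<Sum>e\<in>E. (u e)\<^sup>2)" using E by (simp add: power2_eq_square)
    finally have n: "tr (star a * a) = (\<Sum>e\<in>E. (u e)\<^sup>2)" .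
    have u: "\<bar>u e\<bar> \<le> sqrt (tr (star a * a))" if "e \<in> E" for e
    proof (rule real_le_rsqrt)
      show "\<bar>u e\<bar>\<^sup>2 \<le> tr (star a * a)"
        unfolding n using member_le_sum[of e E "\<lambda>e. (u e)\<^sup>2"] E that by simp
    qed
    have "norm a \<le> (\<Sum>e\<in>E. norm (u e *\<^sub>R e))" unfolding a by (rule norm_sum)
    also have "\<dots> \<le> (\<Sum>e\<in>E. sqrt (tr (star a * a)) * norm e)"
      using u by (intro sum_mono) (simp add: mult_right_mono)
    also have "\<dots> = (C - 1) * sqrt (tr (star a * a))"
      by (simp add: C_def sum_distrib_right mult.commute)
    also have "\<dots> \<le> C * sqrt (tr (star a * a))"
      using tr_star_mult_nonneg[of a] by (intro mult_right_mono) auto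
    finally show ?thesis .
  qed
  moreover have "C > 0" by (simp add: C_def add_pos_nonneg sum_nonneg)
  ultimately show thesis using that by blast
qed

text \<open>An eigenvalue of \<open>k\<close> is at most \<open>\<parallel>k\<parallel>\<close> in absolute value, by submultiplicativity of the norm.\<close>

lemma norm_minus_positive:
  fixes k :: 'a
  assumes k: "star k = k"
  shows "norm k *\<^sub>R 1 - k \<in> positive_elements"
  unfolding positive_iff_eigenvalues_nonneg[OF fd]
proof (intro conjI allI impI)
  show "star (norm k *\<^sub>R 1 - k) = norm k *\<^sub>R 1 - k" by (simp add: star_diff star_scaleR k)
  fix x c assume c: "c \<noteq> 0" "(norm k *\<^sub>R 1 - k) * c = x *\<^sub>R c"
  then have "k * c = (norm k - x) *\<^sub>R c" by (simp add: algebra_simps)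
  then have "\<bar>norm k - x\<bar> * norm c \<le> norm k * norm c"
    using norm_mult_ineq[of k c] by simp
  then show "x \<ge> 0" using c by simp
qed

section \<open>Continuity of the square root\<close>

text \<open>
  Let \<open>d = r - s\<close>, \<open>k = r\<^sup>2 - s\<^sup>2 = d r + s d\<close>, and let \<open>p\<close> be the eigenprojection of \<open>d\<close> for \<open>z\<close>.  Then
  \<open>tr (p k) = z (tr (p r) + tr (p s))\<close>, whereas \<open>tr (p r) - tr (p s) = tr (p d) = z tr p\<close>.  As
  \<open>tr (p r)\<close> and \<open>tr (p s)\<close> are nonnegative, their sum is at least \<open>|z| tr p\<close>, so
  \<open>z\<^sup>2 tr p \<le> |tr (p k)| \<le> \<parallel>k\<parallel> tr p\<close>.  Summation over the eigenvalues of \<open>d\<close> gives the claim.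
\<close>

lemma sqrt_diff_trace_norm:
  assumes r: "r \<in> positive_elements" and s: "s \<in> positive_elements"
  shows "tr (star (r - s) * (r - s)) \<le> norm (r * r - s * s) * tr 1"
proof -
  define d where "d = r - s"
  define k where "k = r * r - s * s"
  note sa = positive_selfadjoint[OF r] positive_selfadjoint[OF s]
  have d: "star d = d" by (simp add: d_def star_diff sa)
  have k: "star k = k" by (simp add: k_def star_diff star_mult sa)
  have k_eq: "k = d * r + s * d" by (simp add: k_def d_def algebra_simps)
  obtain S p where S: "spectral_resolution d S p" by (rule spectral_resolution_exists[OF fd d])
  have le: "z * z * tr (p z) \<le> norm k * tr (p z)" if z: "z \<in> S" for z
  proof -
    have p: "star (p z) = p z" "p z * p z = p z" "d * p z = z *\<^sub>R p z"
      using S z by (auto simp: spectral_resolution_def)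
    have pd: "p z * d = z *\<^sub>R p z"
      using arg_cong[OF p(3), of star] by (simp add: star_mult star_scaleR p(1) d)
    have pp: "p z \<in> positive_elements" using star_mult_positive[of "p z"] p by simp
    have nonneg: "tr (p z * r) \<ge> 0" "tr (p z * s) \<ge> 0" "tr (p z) \<ge> 0"
      using pp r s by (auto intro: tr_mult_nonneg tr_positive)
    have "tr (p z * (s * d)) = tr (d * p z * s)"
      by (subst mult.assoc[symmetric], subst tr_commute) (simp add: mult.assoc)
    then have pk: "tr (p z * k) = z * (tr (p z * r) + tr (p z * s))"
      by (simp add: k_eq distrib_left tr_add pd p(3) tr_scaleR flip: mult.assoc)
    have dz: "tr (p z * r) - tr (p z * s) = z * tr (p z)"
      using pd by (simp add: d_def right_diff_distrib tr_scaleR flip: tr_diff)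
    have bd: "tr (p z * k) \<le> norm k * tr (p z)" "- tr (p z * k) \<le> norm k * tr (p z)"
      using tr_mult_nonneg[OF pp norm_minus_positive[OF k]]
        tr_mult_nonneg[OF pp norm_minus_positive[of "- k"]] k
      by (simp_all add: right_diff_distrib distrib_left tr_diff tr_add tr_scaleR star_minus tr_minus)
    have "z * z * tr (p z) = \<bar>z\<bar> * \<bar>z * tr (p z)\<bar>"
      using nonneg by (simp add: abs_mult flip: mult.assoc)
    also have "\<dots> \<le> \<bar>z\<bar> * (tr (p z * r) + tr (p z * s))"
      using nonneg by (intro mult_left_mono) (auto simp flip: dz)
    also have "\<dots> = \<bar>tr (p z * k)\<bar>" using nonneg by (simp add: pk abs_mult)
    also have "\<dots> \<le> norm k * tr (p z)" using bd by linarith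
    finally show ?thesis .
  qed
  have "star d * d = spectral_sum S p (\<lambda>z. z * z)"
    unfolding d using spectral_sum_mult[OF S, of "\<lambda>z. z" "\<lambda>z. z"] by (simp add: spectral_sum_id[OF S])
  then have "tr (star d * d) = (\<Sum>z\<in>S. z * z * tr (p z))"
    by (simp add: spectral_sum_def tr_sum tr_scaleR)
  also have "\<dots> \<le> (\<Sum>z\<in>S. norm k * tr (p z))" using le by (rule sum_mono)
  also have "\<dots> = norm k * tr 1"
    using S by (simp add: spectral_resolution_def flip: sum_distrib_left tr_sum)
  finally show ?thesis by (simp add: d_def k_def)
qed

section \<open>Polar decomposition\<close>

text \<open>
  With \<open>m = |a|\<close>, the partial isometry is \<open>u = a f(m)\<close> for the pseudo-inverse \<open>f(z) = 1/z\<close>, \<open>f(0) = 0\<close>;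
  \<open>P\<close> and \<open>E\<close> are the projections onto the range and the kernel of \<open>m\<close>.  The kernel of \<open>m\<close> is killed
  by \<open>a\<close> as well, because \<open>(a E)\<^sup>* (a E) = E m\<^sup>2 E = 0\<close>.
\<close>

lemma polar_decomposition:
  fixes a :: 'a
  obtains u where "star u * a = cstar_abs a" "u * cstar_abs a = a" "u * star u * u = u"
proof -
  define m where "m = cstar_abs a"
  have m: "star m = m" "m * m = star a * a"
    using pos_sqrt_works[OF star_mult_positive[of a]] by (simp_all add: m_def cstar_abs_def)
  obtain S p where S: "spectral_resolution m S p" by (rule spectral_resolution_exists[OF fd m(1)])
  note mult = spectral_sum_mult[OF S]
  define f where "f = (\<lambda>z::real. if z = 0 then 0 else 1 / z)"
  define F where "F = spectral_sum S p f"
  define E where "E = spectral_sum S p (\<lambda>z. if z = 0 then 1 else 0)"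
  define P where "P = spectral_sum S p (\<lambda>z. if z = 0 then 0 else 1)"
  have sF: "star F = F" and sE: "star E = E" by (simp_all add: F_def E_def star_spectral_sum[OF S])
  have id: "spectral_sum S p (\<lambda>z. z) = m" by (rule spectral_sum_id[OF S])
  have Fm: "F * m = P" unfolding F_def P_def id[symmetric] mult by (rule spectral_sum_cong) (simp add: f_def)
  have FP: "F * P = F" unfolding F_def P_def mult by (rule spectral_sum_cong) (simp add: f_def)
  have mF: "m * F = P" unfolding F_def P_def id[symmetric] mult by (rule spectral_sum_cong) (simp add: f_def)
  have Pm: "P * m = m" unfolding P_def id[symmetric] mult by (rule spectral_sum_cong) simp
  have PP: "P * P = P" unfolding P_def mult by (rule spectral_sum_cong) simp
  have mE: "m * E = 0" unfolding E_def id[symmetric] mult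
    by (auto simp: spectral_sum_def intro!: sum.neutral)
  have "P + E = (\<Sum>z\<in>S. p z)"
    unfolding P_def E_def spectral_sum_def sum.distrib[symmetric] by (rule sum.cong) auto
  then have PE: "P + E = 1" using S by (simp add: spectral_resolution_def)
  have "star (a * E) * (a * E) = E * (star a * a) * E" by (simp add: star_mult sE mult.assoc)
  also have "\<dots> = E * m * (m * E)" by (simp add: mult.assoc flip: m(2))
  finally have aE: "a * E = 0" by (simp add: mE star_mult_self_eq_0)
  have aP: "a * P = a"
  proof -
    have "a * (P + E) = a" by (simp add: PE)
    then show ?thesis by (simp add: distrib_left aE)
  qed
  show thesis
  proof
    have "star (a * F) * a = F * (star a * a)" by (simp add: star_mult sF mult.assoc)
    also have "\<dots> = F * m * m" by (simp add: mult.assoc flip: m(2))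
    finally have uam: "star (a * F) * a = m" by (simp add: Fm Pm)
    then show "star (a * F) * a = cstar_abs a" by (simp add: m_def)
    show "a * F * cstar_abs a = a" by (simp add: mult.assoc Fm aP flip: m_def)
    have "a * F * star (a * F) * (a * F) = a * F * (star (a * F) * a * F)" by (simp add: mult.assoc)
    also have "\<dots> = a * (F * P)" unfolding uam by (simp add: mF mult.assoc)
    finally show "a * F * star (a * F) * (a * F) = a * F" by (simp add: FP)
  qed
qed

lemma projection_pythagoras:
  assumes "star q = q" "q * q = q"
  shows "tr (star g * q * g) + tr (star (g - q * g) * (g - q * g)) = tr (star g * g)"
proof -
  have "star (q * g) * (q * g) = star g * (q * q) * g" by (simp add: star_mult assms(1) mult.assoc)
  then have "star (q * g) * (q * g) = star g * q * g" by (simp add: assms(2))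
  moreover have "star g * (q * g) = star g * q * g" by (simp add: mult.assoc)
  moreover note tr_star_mult_commute[of g "q * g"]
  ultimately show ?thesis by (simp add: tr_star_mult_diff)
qed

text \<open>If \<open>a = u |a|\<close> and \<open>|a| = g\<^sup>2\<close>, then \<open>tr a = tr (g\<^sup>* (u g))\<close> is an inner product of two elements
  whose squared norms are at most \<open>tr |a|\<close>.\<close>

lemma tr_le_tr_abs: "tr a \<le> tr (cstar_abs a)"
proof -
  obtain u where u: "u * cstar_abs a = a" "u * star u * u = u" using polar_decomposition[of a] by metis
  have abs_pos: "cstar_abs a \<in> positive_elements"
    unfolding cstar_abs_def by (rule pos_sqrt_works(1)[OF star_mult_positive])
  obtain g where g: "g \<in> positive_elements" "g * g = cstar_abs a" using positive_has_sqrt[OF abs_pos] by blast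
  have sg: "star g = g" using g(1) by (rule positive_selfadjoint)
  have "star u * u * (star u * u) = star u * (u * star u * u)" by (simp add: mult.assoc)
  then have q: "star (star u * u) = star u * u" "star u * u * (star u * u) = star u * u"
    by (simp_all add: u(2) star_mult star_star)
  have "tr (star (u * g) * (u * g)) = tr (star g * (star u * u) * g)" by (simp add: star_mult mult.assoc)
  then have ug: "tr (star (u * g) * (u * g)) \<le> tr (star g * g)"
    using projection_pythagoras[OF q, of g] tr_star_mult_nonneg[of "g - star u * u * g"] by linarith
  have "tr a = tr (u * g * g)" by (simp add: mult.assoc g u)
  also have "\<dots> = tr (star g * (u * g))" by (subst tr_commute) (simp add: sg)
  finally have "2 * tr a \<le> tr (star g * g) + tr (star (u * g) * (u * g))"
    using tr_star_mult_diff[of g "u * g"] tr_star_mult_nonneg[of "g - u * g"] by linarith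
  moreover have "tr (star g * g) = tr (cstar_abs a)" by (simp add: sg g)
  ultimately show ?thesis using ug by linarith
qed

section \<open>The Bures distance against the norm\<close>

lemma bures_dist_eq: "bures_dist \<tau> x y = sqrt (1 - tr (cstar_abs (pos_sqrt x * pos_sqrt y)))"
  by (simp add: bures_dist_def tr_def)

lemma density_sqrt:
  assumes "x \<in> density_space \<tau>"
  shows "pos_sqrt x \<in> positive_elements" "pos_sqrt x * pos_sqrt x = x" "star (pos_sqrt x) = pos_sqrt x"
    "tr (star (pos_sqrt x) * pos_sqrt x) = 1" "tr x = 1"
proof -
  have "x \<in> positive_elements" "tr x = 1" using assms by (auto simp: density_space_def tr_def)
  then show "pos_sqrt x \<in> positive_elements" "pos_sqrt x * pos_sqrt x = x" "star (pos_sqrt x) = pos_sqrt x"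
    "tr (star (pos_sqrt x) * pos_sqrt x) = 1" "tr x = 1"
    by (simp_all add: pos_sqrt_works)
qed

text \<open>Both steps of the estimate are in the identity \<open>\<parallel>r - s\<parallel>\<^sub>2\<^sup>2 = 2 - 2 tr (rs)\<close>: its left-hand side is
  controlled by \<open>\<parallel>x - y\<parallel>\<close>, its right-hand side controls the Bures distance.\<close>

lemma bures_dist_le_norm:
  assumes x: "x \<in> density_space \<tau>" and y: "y \<in> density_space \<tau>"
  shows "bures_dist \<tau> x y \<le> sqrt (norm (x - y) * tr 1 / 2)"
proof -
  note rs = density_sqrt[OF x] density_sqrt[OF y]
  let ?r = "pos_sqrt x" and ?s = "pos_sqrt y"
  have "2 - 2 * tr (star ?r * ?s) \<le> norm (x - y) * tr 1"
    using sqrt_diff_trace_norm[OF rs(1,6)] by (simp add: tr_star_mult_diff rs del: One_nat_def)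
  moreover have "tr (star ?r * ?s) \<le> tr (cstar_abs (?r * ?s))"
    using tr_le_tr_abs[of "?r * ?s"] rs by simp
  ultimately show ?thesis unfolding bures_dist_eq by (intro real_sqrt_le_mono) linarith
qed

text \<open>
  With \<open>q = u u\<^sup>*\<close>, \<open>v = r u\<close> and \<open>w = (1 - q) r\<close>, the vectors \<open>w\<close> and \<open>v - s\<close> both have squared trace
  norm at most \<open>2 b\<^sup>2\<close>, and \<open>x - y = w\<^sup>* w + (v - s) v\<^sup>* + s (v - s)\<^sup>*\<close>.  The bound on \<open>v - s\<close> uses
  \<open>\<parallel>v\<parallel>\<^sub>2 \<le> 1\<close>; the one on \<open>w\<close> uses \<open>\<parallel>w\<parallel>\<^sub>2\<^sup>2 = 1 - \<parallel>v\<parallel>\<^sub>2\<^sup>2\<close> and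
  \<open>\<parallel>v\<parallel>\<^sub>2\<^sup>2 \<ge> 2 tr (v\<^sup>* s) - 1 = 1 - 2 b\<^sup>2\<close>.
\<close>

lemma norm_le_bures_dist:
  assumes C: "C > 0" "\<And>a. norm a \<le> C * sqrt (tr (star a * a))"
    and x: "x \<in> density_space \<tau>" and y: "y \<in> density_space \<tau>"
  defines "b \<equiv> bures_dist \<tau> x y"
  shows "0 \<le> b" and "norm (x - y) \<le> C\<^sup>2 * (2 * b\<^sup>2 + 2 * sqrt 2 * b)"
proof -
  define r where "r = pos_sqrt x"
  define s where "s = pos_sqrt y"
  have r: "r * r = x" "star r = r" "tr (star r * r) = 1"
    and s: "s * s = y" "star s = s" "tr (star s * s) = 1"
    using density_sqrt[OF x] density_sqrt[OF y] by (simp_all add: r_def s_def)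
  obtain u where u: "star u * (r * s) = cstar_abs (r * s)" "u * star u * u = u"
    using polar_decomposition[of "r * s"] by metis
  define q where "q = u * star u"
  have "q * q = u * star u * u * star u" by (simp add: q_def mult.assoc)
  then have q: "star q = q" "q * q = q" by (simp_all add: u(2) star_mult star_star q_def)
  define v where "v = r * u"
  define w where "w = r - q * r"
  have vv: "v * star v = r * q * r" by (simp add: v_def q_def star_mult r mult.assoc)
  have tvv: "tr (star v * v) = tr (star r * q * r)" by (simp add: r vv tr_commute[of "star v" v])
  have vw: "tr (star v * v) + tr (star w * w) = 1"
    using projection_pythagoras[OF q, of r] by (simp add: tvv w_def r(3))
  have vs: "tr (star v * s) = tr (cstar_abs (r * s))"
    by (simp add: v_def star_mult r mult.assoc u(1))
  have diff: "tr (star (v - s) * (v - s)) = tr (star v * v) + 1 - 2 * tr (cstar_abs (r * s))"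
    by (simp add: tr_star_mult_diff s(3) vs)
  note nonneg = tr_star_mult_nonneg[of w] tr_star_mult_nonneg[of "v - s"]
  have "1 - tr (cstar_abs (r * s)) \<ge> 0" using vw diff nonneg by linarith
  then have b: "b\<^sup>2 = 1 - tr (cstar_abs (r * s))" "b \<ge> 0"
    by (simp_all add: b_def bures_dist_eq r_def s_def)
  show "0 \<le> b" by (fact b(2))
  have w2: "tr (star w * w) \<le> 2 * b\<^sup>2" and d2: "tr (star (v - s) * (v - s)) \<le> 2 * b\<^sup>2"
    using vw diff nonneg b(1) by linarith+
  have v1: "tr (star v * v) \<le> 1" using vw nonneg by linarith
  have small: "norm a \<le> C * sqrt k" if "tr (star a * a) \<le> k" for a k
  proof -
    have "C * sqrt (tr (star a * a)) \<le> C * sqrt k" using that C(1) by (intro mult_left_mono) auto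
    then show ?thesis using C(2)[of a] by linarith
  qed
  have nv: "norm v \<le> C" and ns: "norm s \<le> C"
    using small[OF v1] small[of s 1] s(3) by simp_all
  have root: "sqrt (2 * b\<^sup>2) = sqrt 2 * b" using b(2) by (simp add: real_sqrt_mult)
  have nd: "norm (v - s) \<le> C * (sqrt 2 * b)" and nw: "norm w \<le> C * (sqrt 2 * b)"
    using small[OF d2] small[OF w2] by (simp_all only: root)
  have "star w * w = r * r - r * q * r"
  proof -
    have "star w * w = r * r - r * q * r - (r * q * r - r * (q * q) * r)"
      by (simp add: w_def star_diff star_mult r q(1) left_diff_distrib right_diff_distrib mult.assoc)
    then show ?thesis by (simp add: q(2))
  qed
  then have "x - y = star w * w + ((v - s) * star v + s * star (v - s))"
    by (simp add: left_diff_distrib right_diff_distrib star_diff vv r s)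
  then have "norm (x - y) \<le> norm (star w * w) + (norm ((v - s) * star v) + norm (s * star (v - s)))"
    by (metis norm_triangle_le add_left_mono norm_triangle_ineq)
  also have "\<dots> \<le> (norm w)\<^sup>2 + (norm (v - s) * norm v + norm s * norm (v - s))"
    using norm_mult_ineq[of "v - s" "star v"] norm_mult_ineq[of s "star (v - s)"]
    by (simp add: cstar_identity norm_star)
  also have "\<dots> \<le> (C * (sqrt 2 * b))\<^sup>2 + (C * (sqrt 2 * b) * C + C * (C * (sqrt 2 * b)))"
    using nw nd nv ns C(1) b(2) by (intro add_mono mult_mono power_mono) auto
  also have "\<dots> = C\<^sup>2 * (2 * b\<^sup>2 + 2 * sqrt 2 * b)"
    by (simp add: power_mult_distrib algebra_simps power2_eq_square)
  finally show "norm (x - y) \<le> C\<^sup>2 * (2 * b\<^sup>2 + 2 * sqrt 2 * b)" .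
qed

end

section \<open>Equality of the topologies\<close>

lemma openin_induced_topology_mono:
  assumes "\<And>x r. x \<in> M \<Longrightarrow> r > 0 \<Longrightarrow> \<exists>s>0. \<forall>y\<in>M. e x y < s \<longrightarrow> d x y < r"
    and "openin (induced_topology M d) U"
  shows "openin (induced_topology M e) U"
  unfolding openin_induced_topology
proof (intro conjI ballI)
  have U: "U \<subseteq> M" "\<And>x. x \<in> U \<Longrightarrow> \<exists>r>0. {y \<in> M. d x y < r} \<subseteq> U"
    using assms(2) unfolding openin_induced_topology by auto
  show "U \<subseteq> M" by (fact U(1))
  fix x assume x: "x \<in> U"
  then obtain r where r: "r > 0" "{y \<in> M. d x y < r} \<subseteq> U" using U(2) by blast
  obtain s where "s > 0" "\<forall>y\<in>M. e x y < s \<longrightarrow> d x y < r" using assms(1)[of x r] U x r by blast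
  then show "\<exists>s>0. {y \<in> M. e x y < s} \<subseteq> U" using r(2) by (intro exI[of _ s]) auto
qed

theorem theorem3p5:
  fixes \<tau> :: "'a::unital_cstar_algebra \<Rightarrow> complex"
  assumes "faithful_trace \<tau>"
    and "finite_dim_algebra TYPE('a)"
  shows "induced_topology (density_space \<tau>) cstar_dist =
         induced_topology (density_space \<tau>) (bures_dist \<tau>)"
proof -
  interpret finite_dim_tracial \<tau> using assms by unfold_locales
  have bures_le: "\<exists>\<delta>>0. \<forall>y\<in>density_space \<tau>. cstar_dist x y < \<delta> \<longrightarrow> bures_dist \<tau> x y < \<epsilon>"
    if x: "x \<in> density_space \<tau>" and e: "\<epsilon> > 0" for x \<epsilon>
  proof (intro exI conjI ballI impI)
    have "x \<noteq> 0" using x tau_scaleC[of 0 0] by (auto simp: density_space_def)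
    then have t: "tr 1 > 0" using tr_star_mult_pos[of 1] by (metis mult.right_neutral mult_zero_right star_1)
    show "2 * \<epsilon>\<^sup>2 / tr 1 > 0" using e t by simp
    fix y assume y: "y \<in> density_space \<tau>" and d: "cstar_dist x y < 2 * \<epsilon>\<^sup>2 / tr 1"
    have "norm (x - y) * tr 1 / 2 < \<epsilon>\<^sup>2" using d t by (simp add: cstar_dist_def field_simps)
    then have "sqrt (norm (x - y) * tr 1 / 2) < \<epsilon>" using e by (simp add: real_less_lsqrt)
    then show "bures_dist \<tau> x y < \<epsilon>" using bures_dist_le_norm[OF x y] by linarith
  qed
  have norm_le: "\<exists>\<delta>>0. \<forall>y\<in>density_space \<tau>. bures_dist \<tau> x y < \<delta> \<longrightarrow> cstar_dist x y < \<epsilon>"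
    if x: "x \<in> density_space \<tau>" and e: "\<epsilon> > 0" for x \<epsilon>
  proof -
    obtain C where C: "C > 0" "\<And>a. norm a \<le> C * sqrt (tr (star a * a))" using norm_le_trace_norm by blast
    define g where "g b = C\<^sup>2 * (2 * b\<^sup>2 + 2 * sqrt 2 * b)" for b
    have "isCont g 0" unfolding g_def by (intro continuous_intros)
    then have "\<exists>\<delta>>0. \<forall>b. \<bar>b\<bar> < \<delta> \<longrightarrow> \<bar>g b - g 0\<bar> < \<epsilon>"
      using e unfolding continuous_at_eps_delta by (auto simp: dist_real_def)
    then obtain \<delta> where \<delta>: "\<delta> > 0" "\<And>b. \<bar>b\<bar> < \<delta> \<Longrightarrow> \<bar>g b\<bar> < \<epsilon>" by (auto simp: g_def)
    show ?thesis
    proof (intro exI conjI ballI impI)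
      show "\<delta> > 0" by fact
      fix y assume y: "y \<in> density_space \<tau>" and b: "bures_dist \<tau> x y < \<delta>"
      have "norm (x - y) \<le> g (bures_dist \<tau> x y)"
        unfolding g_def by (rule norm_le_bures_dist(2)[OF C x y])
      moreover have "bures_dist \<tau> x y \<ge> 0" by (rule norm_le_bures_dist(1)[OF C x y])
      ultimately show "cstar_dist x y < \<epsilon>"
        using \<delta>(2)[of "bures_dist \<tau> x y"] b by (auto simp: cstar_dist_def)
    qed
  qed
  show ?thesis
    unfolding topology_eq
    using openin_induced_topology_mono[OF norm_le] openin_induced_topology_mono[OF bures_le] by (intro allI iffI)
qed

end
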